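(* Minimum representation fairness (MR-fairness) is incompatible with proportional fairness. That is, there exist a fair clustering instance $(\mathcal X,\mathcal G)$ with a number of clusters $K$ and an MR-fairness parameter $(\alpha,\boldsymbol\beta)$ such that, for every non-trivial parameter $(p_{lg},p_{ug})_{g\in\mathcal G}$ of proportional fairness, no clustering of $\mathcal X$ into $K$ clusters is both $(\alpha,\boldsymbol\beta)$-minimum representation fair and proportionally fair with parameter $(p_{lg},p_{ug})_{g\in\mathcal G}$.
   Context: A fair clustering instance consists of $n$ indexed data points $\mathcal X=\{x^1,\dots,x^n\}\subset\mathbb R^m$ and groups: there is a finite set $\mathcal F$ of sensitive features, each $f\in\mathcal F$ has a finite set of values $\mathcal G_f$, $\mathcal G=\bigcup_f\mathcal G_f$ is the set of groups, $X_g\subseteq\mathcal X$ is the set of points in group $g$, and $\{X_g\}_{g\in\mathcal G_f}$ partitions $\mathcal X$ for each $f$. A clustering is a partition $\mathcal C=\{C_1,\dots,C_K\}$ of $\mathcal X$ into $K$ nonempty clusters. MR-fairness: for $\alpha\in(0,1]$, group $g$ is $\alpha$-represented in $C_k$ if $|C_k\cap X_g|\ge\alpha|C_k|$; $\Lambda(\mathcal C,X_g,\alpha)$ is the number of clusters in which $g$ is $\alpha$-represented. For $\boldsymbol\beta=(\beta_g)_{g\in\mathcal G}$ with $\beta_g\in\mathbb Z^+$, $\mathcal C$ is $(\alpha,\boldsymbol\beta)$-minimum representation fair if $\Lambda(\mathcal C,X_g,\alpha)\ge\beta_g$ for every $g\in\mathcal G$. Proportional fairness with parameters $p_{lg},p_{ug}\in[0,1]$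 ($g\in\mathcal G$): $p_{lg}|C_k|\le|C_k\cap X_g|\le p_{ug}|C_k|$ for all $k\in\{1,\dots,K\}$ and all $g\in\mathcal G$. Incompatibility: for a parametrized fairness criterion $f_{\mathbf p}$, let $\Psi(\mathcal X,\mathcal G,f_{\mathbf p})$ be the set of clusterings satisfying it. A criterion $f$ is incompatible with a criterion $g$ if there exist an instance $\mathcal X,\mathcal G$ and a parameter $\mathbf p_1$ for $f$ with $\Psi(\mathcal X,\mathcal G,f_{\mathbf p_1})\cap\Psi(\mathcal X,\mathcal G,g_{\mathbf p_2})=\emptyset$ for all non-trivial $\mathbf p_2$, where a parameter is non-trivial if it is not satisfied by all clusterings of the dataset. *)

theory Defs
  imports Complex_Main "HOL-Library.Disjoint_Sets" "Jordan_Normal_Form.Matrix"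
begin

text \<open>
  A dataset with sensitive features. The data points are indexed, hence possibly repeated, so
  groups and clusters are sets of indices in \<open>{1..num_points}\<close> rather than sets of vectors.
  Vectors with an explicit carrier are used because the dimension is part of the instance.
  There are finitely many features and groups, and they are labelled by natural numbers.
\<close>

record fair_instance =
  dimension :: nat
  num_points :: nat
  point :: "nat \<Rightarrow> real vec"
  features :: "nat set"
  feature_values :: "nat \<Rightarrow> nat set"
  group_points :: "nat \<Rightarrow> nat set"

definition indices :: "fair_instance \<Rightarrow> nat set" where
  "indices I = {1..num_points I}"

definition groups :: "fair_instance \<Rightarrow> nat set" where
  "groups I = (\<Union>f\<in>features I. feature_values I f)"

text \<open>
  The condition \<open>disjoint_family_on\<close> makes the partition an indexed one: distinct values of a
  feature are carried by disjoint groups, which \<open>partition_on\<close> of the image alone does not imply.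
\<close>

definition valid_instance :: "fair_instance \<Rightarrow> bool" where
  "valid_instance I \<longleftrightarrow>
     1 \<le> dimension I \<and> 1 \<le> num_points I \<and>
     (\<forall>i\<in>indices I. point I i \<in> carrier_vec (dimension I)) \<and>
     finite (features I) \<and> features I \<noteq> {} \<and>
     (\<forall>f\<in>features I.
        finite (feature_values I f) \<and>
        disjoint_family_on (group_points I) (feature_values I f) \<and>
        partition_on (indices I) (group_points I ` feature_values I f))"

definition clusterings :: "fair_instance \<Rightarrow> nat \<Rightarrow> nat set set set" where
  "clusterings I K = {\<C>. partition_on (indices I) \<C> \<and> card \<C> = K}"

text \<open>A parametrized fairness criterion, together with its range of admissible parameters.\<close>

record 'p criterion =
  parameters :: "fair_instance \<Rightarrow> 'p set"
  fair :: "fair_instance \<Rightarrow> 'p \<Rightarrow> nat set set \<Rightarrow> bool"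

definition fair_clusterings ::
    "fair_instance \<Rightarrow> nat \<Rightarrow> 'p criterion \<Rightarrow> 'p \<Rightarrow> nat set set set" where
  "fair_clusterings I K F p = {\<C> \<in> clusterings I K. fair F I p \<C>}"

definition nontrivial :: "fair_instance \<Rightarrow> nat \<Rightarrow> 'p criterion \<Rightarrow> 'p \<Rightarrow> bool" where
  "nontrivial I K F p \<longleftrightarrow> \<not> (\<forall>\<C>\<in>clusterings I K. fair F I p \<C>)"

text \<open>The bounds on \<open>K\<close> say exactly that clusterings into \<open>K\<close> nonempty clusters exist.\<close>

definition incompatible :: "'p criterion \<Rightarrow> 'q criterion \<Rightarrow> bool" where
  "incompatible F G \<longleftrightarrow>
     (\<exists>I K p1. valid_instance I \<and> 1 \<le> K \<and> K \<le> num_points I \<and> p1 \<in> parameters F I \<and>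
        (\<forall>p2\<in>parameters G I. nontrivial I K G p2 \<longrightarrow>
           fair_clusterings I K F p1 \<inter> fair_clusterings I K G p2 = {}))"

definition represented :: "real \<Rightarrow> nat set \<Rightarrow> nat set \<Rightarrow> bool" where
  "represented \<alpha> X C \<longleftrightarrow> real (card (C \<inter> X)) \<ge> \<alpha> * real (card C)"

definition num_represented :: "nat set set \<Rightarrow> nat set \<Rightarrow> real \<Rightarrow> nat" where
  "num_represented \<C> X \<alpha> = card {C \<in> \<C>. represented \<alpha> X C}"

definition mr_fairness :: "(real \<times> (nat \<Rightarrow> nat)) criterion" where
  "mr_fairness =
     \<lparr>parameters = (\<lambda>I. {(\<alpha>, \<beta>). 0 < \<alpha> \<and> \<alpha> \<le> 1 \<and> (\<forall>g\<in>groups I. 1 \<le> \<beta> g)}),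
      fair = (\<lambda>I (\<alpha>, \<beta>) \<C>. \<forall>g\<in>groups I. num_represented \<C> (group_points I g) \<alpha> \<ge> \<beta> g)\<rparr>"

definition proportional_fairness :: "((nat \<Rightarrow> real) \<times> (nat \<Rightarrow> real)) criterion" where
  "proportional_fairness =
     \<lparr>parameters = (\<lambda>I. {(pl, pu). \<forall>g\<in>groups I. pl g \<in> {0..1} \<and> pu g \<in> {0..1}}),
      fair = (\<lambda>I (pl, pu) \<C>. \<forall>C\<in>\<C>. \<forall>g\<in>groups I.
        pl g * real (card C) \<le> real (card (C \<inter> group_points I g)) \<and>
        real (card (C \<inter> group_points I g)) \<le> pu g * real (card C))\<rparr>"

end

theory Submission
  imports Defs
begin

text \<open>
  Minimum representation with threshold \<open>\<alpha> = 1\<close> asks for clusters that lie inside a single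
  group, while proportional bounds ask every cluster to mix the groups in similar proportions.
  If every feature has at least two values and every group owns a cluster, then for each group
  \<open>g\<close> there is a cluster inside \<open>g\<close>, where the proportion of \<open>g\<close> is one, and a cluster inside
  another group of the same feature, where the proportion of \<open>g\<close> is zero. Bounds that tolerate
  both extremes have \<open>p\<^sub>l \<le> 0\<close> and \<open>p\<^sub>u \<ge> 1\<close>, and these constrain nothing
  (lemma \<open>proportional_fairness_trivial\<close>).

  The witness has four points, one feature with the two groups \<open>{1, 2}\<close> and \<open>{3, 4}\<close>, and
  \<open>K = 2\<close>. Its conflict is genuine on both sides: the two groups themselves form a clustering
  that is minimum representation fair for \<open>\<alpha> = 1\<close> and \<open>\<beta> = 1\<close>, and the clustering
  \<open>{{1, 3}, {2, 4}}\<close> satisfies the non-trivial proportional bounds \<open>p\<^sub>l = p\<^sub>u = 1/2\<close>.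
\<close>

lemma finite_cluster:
  assumes "\<C> \<in> clusterings I K" and "C \<in> \<C>"
  shows "finite C" and "C \<noteq> {}"
proof -
  have part: "partition_on (indices I) \<C>"
    using assms(1) by (simp add: clusterings_def)
  have "C \<subseteq> indices I"
    using partition_onD1[OF part] assms(2) by blast
  then show "finite C"
    unfolding indices_def by (rule finite_subset) simp
  show "C \<noteq> {}"
    using partition_onD3[OF part] assms(2) by blast
qed

lemma fully_represented_imp_subset:
  assumes "finite C" and "represented 1 X C"
  shows "C \<subseteq> X"
proof -
  have "card C \<le> card (C \<inter> X)"
    using assms(2) by (simp add: represented_def)
  then have "C \<inter> X = C"
    using assms(1) by (intro card_seteq) auto
  then show ?thesis by blast
qed

lemma mr_fair_pure_cluster:
  assumes "\<C> \<in> fair_clusterings I K mr_fairness (1, \<lambda>_. 1)" and "g \<in> groups I"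
  obtains C where "C \<in> \<C>" and "C \<subseteq> group_points I g"
proof -
  have clust: "\<C> \<in> clusterings I K"
    and num: "1 \<le> num_represented \<C> (group_points I g) 1"
    using assms by (auto simp: fair_clusterings_def mr_fairness_def)
  have "{C \<in> \<C>. represented 1 (group_points I g) C} \<noteq> {}"
    using num unfolding num_represented_def by (metis card.empty not_one_le_zero)
  then obtain C where "C \<in> \<C>" and "represented 1 (group_points I g) C"
    by blast
  then show thesis
    using that fully_represented_imp_subset finite_cluster(1)[OF clust] by blast
qed

text \<open>
  The lower bound for \<open>g\<close> collapses on a cluster of a competing group, the upper bound on a
  cluster of \<open>g\<close> itself. A competing group must come from the same feature, because groups of
  different features may overlap.
\<close>

lemma proportional_fairness_trivial:
  assumes valid: "valid_instance I"
    and competing: "\<And>f g. f \<in> features I \<Longrightarrow> g \<in> feature_values I f \<Longrightarrow>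
      \<exists>h\<in>feature_values I f. h \<noteq> g"
    and mr: "\<C> \<in> fair_clusterings I K mr_fairness (1, \<lambda>_. 1)"
    and pf: "\<C> \<in> fair_clusterings I K proportional_fairness p"
  shows "\<not> nontrivial I K proportional_fairness p"
proof -
  obtain pl pu where p: "p = (pl, pu)" by fastforce
  have clust: "\<C> \<in> clusterings I K"
    using mr by (simp add: fair_clusterings_def)
  have bounds: "pl g * real (card C) \<le> real (card (C \<inter> group_points I g))"
      "real (card (C \<inter> group_points I g)) \<le> pu g * real (card C)"
    if "C \<in> \<C>" "g \<in> groups I" for C g
    using pf that by (auto simp: p fair_clusterings_def proportional_fairness_def)
  have card_pos: "0 < real (card C)" if "C \<in> \<C>" for C
    using finite_cluster[OF clust that] by (simp add: card_gt_0_iff)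
  have extreme: "pl g \<le> 0 \<and> 1 \<le> pu g" if g: "g \<in> groups I" for g
  proof
    obtain f where f: "f \<in> features I" and gf: "g \<in> feature_values I f"
      using g by (auto simp: groups_def)
    obtain h where hf: "h \<in> feature_values I f" and "h \<noteq> g"
      using competing[OF f gf] by blast
    have h: "h \<in> groups I"
      using f hf by (auto simp: groups_def)
    have disj: "group_points I h \<inter> group_points I g = {}"
      using valid f gf hf \<open>h \<noteq> g\<close>
      by (auto simp: valid_instance_def disjoint_family_on_def)
    obtain D where D: "D \<in> \<C>" "D \<subseteq> group_points I h"
      using mr_fair_pure_cluster[OF mr h] .
    have "D \<inter> group_points I g = {}"
      using D(2) disj by blast
    then have "pl g * real (card D) \<le> 0"
      using bounds(1)[OF D(1) g] by simp
    then show "pl g \<le> 0"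
      using card_pos[OF D(1)] by (simp add: mult_le_0_iff)
    obtain C where C: "C \<in> \<C>" "C \<subseteq> group_points I g"
      using mr_fair_pure_cluster[OF mr g] .
    have "real (card C) \<le> pu g * real (card C)"
      using bounds(2)[OF C(1) g] C(2) by (simp add: Int_absorb2)
    then show "1 \<le> pu g"
      using card_pos[OF C(1)] by simp
  qed
  have "fair proportional_fairness I p \<D>" if \<D>: "\<D> \<in> clusterings I K" for \<D>
  proof -
    have "pl g * real (card C) \<le> real (card (C \<inter> group_points I g)) \<and>
        real (card (C \<inter> group_points I g)) \<le> pu g * real (card C)"
      if C: "C \<in> \<D>" and g: "g \<in> groups I" for C g
    proof
      have "pl g * real (card C) \<le> 0"
        using extreme[OF g] by (simp add: mult_le_0_iff)
      then show "pl g * real (card C) \<le> real (card (C \<inter> group_points I g))"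
        by linarith
      have "real (card (C \<inter> group_points I g)) \<le> 1 * real (card C)"
        using finite_cluster(1)[OF \<D> C] by (simp add: card_mono)
      also have "\<dots> \<le> pu g * real (card C)"
        using extreme[OF g] by (intro mult_right_mono) auto
      finally show "real (card (C \<inter> group_points I g)) \<le> pu g * real (card C)" .
    qed
    then show ?thesis
      by (simp add: p proportional_fairness_def)
  qed
  then show ?thesis
    by (simp add: nontrivial_def)
qed

definition two_group_instance :: fair_instance where
  "two_group_instance =
     \<lparr>dimension = 1, num_points = 4, point = (\<lambda>i. vec 1 (\<lambda>_. real i)),
      features = {0}, feature_values = (\<lambda>_. {0, 1}),
      group_points = (\<lambda>g. if g = 0 then {1, 2} else {3, 4})\<rparr>"

lemma valid_two_group_instance: "valid_instance two_group_instance"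
proof -
  have indices: "indices two_group_instance = {1, 2, 3, 4}"
    by (auto simp: indices_def two_group_instance_def)
  have "partition_on {1, 2, 3, 4 :: nat} {{3, 4}, {1, 2}}"
    by (auto simp: partition_on_def disjoint_def)
  then show ?thesis
    unfolding valid_instance_def indices
    by (auto simp: two_group_instance_def disjoint_family_on_def)
qed

theorem proposition1: "incompatible mr_fairness proportional_fairness"
proof -
  let ?I = two_group_instance
  have competing: "\<exists>h\<in>feature_values ?I f. h \<noteq> g" for f g
    by (cases "g = 0") (auto simp: two_group_instance_def)
  have "fair_clusterings ?I 2 mr_fairness (1, \<lambda>_. 1) \<inter>
      fair_clusterings ?I 2 proportional_fairness p = {}"
    if "nontrivial ?I 2 proportional_fairness p" for p
    using proportional_fairness_trivial[OF valid_two_group_instance competing] that by blast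
  moreover have "(1, \<lambda>_. 1) \<in> parameters mr_fairness ?I"
    by (simp add: mr_fairness_def)
  moreover have "2 \<le> num_points ?I"
    by (simp add: two_group_instance_def)
  ultimately show ?thesis
    unfolding incompatible_def using valid_two_group_instance
    by (intro exI[of _ ?I] exI[of _ 2] exI[of _ "(1, \<lambda>_. 1)"]) auto
qed

end
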